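(* For every $\alpha>0$ we have $$\lim_{N\to\infty}N^{\alpha-1}\|\Psi_N\|^2_{\alpha}=\Gamma(\alpha+2)\,\zeta(\alpha+1)>0.$$
   Context: $\mathbb D$ is the open unit disk and $m_2$ is normalized planar Lebesgue measure, $dm_2(z)=\pi^{-1}\,dx\,dy$. For $\alpha>-1$ and $f$ holomorphic in $\mathbb D$, $\|f\|_\alpha^2=(\alpha+1)\int_{\mathbb D}|f(z)|^2(1-|z|^2)^\alpha\,dm_2(z)$. For $N\ge1$, $\Psi_N(z)=\sum_{0\le k<N}\frac1{z-e^{2\pi ik/N}}$. $\Gamma$ and $\zeta$ are the Gamma function and the Riemann zeta-function. *)

theory Defs
  imports "HOL-Analysis.Analysis"
begin

definition m2 :: "complex measure" where
  "m2 = density lborel (\<lambda>_. ennreal (1 / pi))"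

text \<open>
  The Bochner integral is \<open>0\<close> for a non-integrable integrand. Hence an assertion that such norms
  converge to a positive number entails that they are eventually given by convergent integrals.
\<close>

definition weighted_norm :: "real \<Rightarrow> (complex \<Rightarrow> complex) \<Rightarrow> real" where
  "weighted_norm \<alpha> f =
     sqrt ((\<alpha> + 1) * (LINT z:ball 0 1|m2. (cmod (f z))\<^sup>2 * (1 - (cmod z)\<^sup>2) powr \<alpha>))"

definition Psi :: "nat \<Rightarrow> complex \<Rightarrow> complex" where
  "Psi N z = (\<Sum>k<N. 1 / (z - exp (2 * complex_of_real pi * \<i> * of_nat k / of_nat N)))"

text \<open>
  The Dirichlet series of the Riemann zeta-function, which defines it for real \<open>s > 1\<close>. There is no
  analytic continuation: the value is meaningless for \<open>s \<le> 1\<close>.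
\<close>

definition zeta :: "real \<Rightarrow> real" where
  "zeta s = (\<Sum>n. 1 / real (Suc n) powr s)"

end

theory Submission
  imports Defs
begin

text \<open>
  In closed form \<open>\<Psi>\<^sub>N(z) = N z\<^sup>N\<^sup>-\<^sup>1 / (z\<^sup>N - 1)\<close>. The factor \<open>1 / |1 - z\<^sup>N|\<^sup>2\<close> is the Poisson kernel at \<open>z\<^sup>N\<close>
  divided by \<open>1 - |z|\<^sup>2\<^sup>N\<close>, and integrating the Poisson kernel against a radial weight is the same as
  replacing it by \<open>1\<close>. The remaining integrand is radial; in the variable \<open>t = |z|\<^sup>2\<close> the geometric
  series of \<open>1 / (1 - t\<^sup>N)\<close> turns the integral into
  \<open>N\<^sup>2 (\<Sum>k\<ge>1. Beta (N k) (\<alpha> + 1))\<close>. Since \<open>n\<^sup>a Beta n a \<longlonglongrightarrow> Gamma a\<close>, Tannery's theorem gives the limit.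
\<close>

section \<open>Rotation invariance and radial integrals in the plane\<close>

text \<open>
  Uniqueness of translation-invariant measures by Fubini: the image measure is a multiple of \<open>lborel\<close>,
  and the factor is \<open>1\<close> because the unit ball \<open>B\<close> is invariant.
\<close>

lemma distr_orthogonal_lborel:
  fixes f :: "'a::euclidean_space \<Rightarrow> 'a"
  assumes f: "orthogonal_transformation f"
  shows "distr lborel borel f = lborel"
proof (rule measure_eqI)
  fix A :: "'a set" assume "A \<in> sets (distr lborel borel f)"
  then have A [measurable]: "A \<in> sets borel" by simp
  have lin: "linear f" and nf: "norm (f x) = norm x" for x
    using f by (auto simp: orthogonal_transformation_linear orthogonal_transformation_norm)
  have f_meas [measurable]: "f \<in> borel_measurable borel"
    using lin by (intro borel_measurable_continuous_onI linear_continuous_on) (simp add: linear_conv_bounded_linear)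
  \<comment> \<open>Translating \<open>x\<close> by \<open>g y\<close> adds \<open>y\<close> to
    \<open>f x\<close>, so a right inverse turns shifts of the variable into shifts of the image
    point.\<close>
  obtain g where g: "f (g y) = y" for y
    using orthogonal_transformation_surj[OF f] by (metis surjD)
  define B :: "'a set" where "B = ball 0 1"
  have B [measurable]: "B \<in> sets borel" by (simp add: B_def)
  let ?iA = "indicator A :: 'a \<Rightarrow> ennreal" and ?iB = "indicator B :: 'a \<Rightarrow> ennreal"
  have shift: "(\<integral>\<^sup>+x. h (c + x) \<partial>lborel) = (\<integral>\<^sup>+x. h x \<partial>lborel)"
    if "h \<in> borel_measurable borel" for h :: "'a \<Rightarrow> ennreal" and c
    using nn_integral_distr[of "(+) c" lborel borel h] that by (simp add: lborel_distr_plus)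
  have "emeasure (distr lborel borel f) A * emeasure lborel B
      = (\<integral>\<^sup>+x. ?iA (f x) \<partial>lborel) * (\<integral>\<^sup>+y. ?iB y \<partial>lborel)"
    by (simp add: nn_integral_distr flip: nn_integral_indicator)
  also have "\<dots> = (\<integral>\<^sup>+y. (\<integral>\<^sup>+x. ?iA (f x) * ?iB y \<partial>lborel) \<partial>lborel)"
    by (simp add: nn_integral_multc nn_integral_cmult)
  also have "\<dots> = (\<integral>\<^sup>+y. (\<integral>\<^sup>+x. ?iA (y + f x) * ?iB y \<partial>lborel) \<partial>lborel)"
  proof (rule nn_integral_cong)
    fix y :: 'a
    show "(\<integral>\<^sup>+x. ?iA (f x) * ?iB y \<partial>lborel) = (\<integral>\<^sup>+x. ?iA (y + f x) * ?iB y \<partial>lborel)"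
      using shift[of "\<lambda>x. ?iA (f x) * ?iB y" "g y"] by (simp add: linear_add[OF lin] g)
  qed
  also have "\<dots> = (\<integral>\<^sup>+x. (\<integral>\<^sup>+y. ?iA (y + f x) * ?iB y \<partial>lborel) \<partial>lborel)"
    by (rule lborel_pair.Fubini') measurable
  also have "\<dots> = (\<integral>\<^sup>+x. (\<integral>\<^sup>+y. ?iA y * ?iB (y - f x) \<partial>lborel) \<partial>lborel)"
  proof (rule nn_integral_cong)
    fix x :: 'a
    show "(\<integral>\<^sup>+y. ?iA (y + f x) * ?iB y \<partial>lborel) = (\<integral>\<^sup>+y. ?iA y * ?iB (y - f x) \<partial>lborel)"
      using shift[of "\<lambda>y. ?iA y * ?iB (y - f x)" "f x"] by (simp add: add.commute)
  qed
  also have "\<dots> = (\<integral>\<^sup>+y. (\<integral>\<^sup>+x. ?iA y * ?iB (y - f x) \<partial>lborel) \<partial>lborel)"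
    by (rule lborel_pair.Fubini') measurable
  also have "\<dots> = (\<integral>\<^sup>+y. (\<integral>\<^sup>+x. ?iA y * ?iB x \<partial>lborel) \<partial>lborel)"
  proof (rule nn_integral_cong)
    fix y :: 'a
    have "?iB (y - f (g y + x)) = ?iB x" for x
      by (simp add: linear_add[OF lin] g B_def indicator_def nf)
    then show "(\<integral>\<^sup>+x. ?iA y * ?iB (y - f x) \<partial>lborel) = (\<integral>\<^sup>+x. ?iA y * ?iB x \<partial>lborel)"
      using shift[of "\<lambda>x. ?iA y * ?iB (y - f x)" "g y"] by simp
  qed
  also have "\<dots> = emeasure lborel A * emeasure lborel B"
    by (simp add: nn_integral_multc nn_integral_cmult)
  finally have "emeasure (distr lborel borel f) A * emeasure lborel B = emeasure lborel A * emeasure lborel B" .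
  moreover have "emeasure lborel B \<noteq> 0" "emeasure lborel B \<noteq> \<infinity>"
    by (auto simp: B_def emeasure_ball less_imp_neq[OF unit_ball_vol_pos, symmetric])
  ultimately show "emeasure (distr lborel borel f) A = emeasure lborel A"
    by (simp add: mult.commute[of _ "emeasure lborel B"] ennreal_mult_cancel_left)
qed simp

text \<open>A disc of radius r has area pi r^2, so area on the unit disc, pushed forward along z ->
  |z|^2, is pi times Lebesgue measure on (0,1). The two measures \<open>M\<close> and
  \<open>U\<close> are compared on the half-lines \<open>{x<..}\<close>; finite values there
  determine a measure on the line.\<close>

lemma nn_integral_radial_disc:
  fixes h :: "real \<Rightarrow> ennreal"
  assumes [measurable]: "h \<in> borel_measurable borel"
  shows "(\<integral>\<^sup>+z. h ((cmod z)\<^sup>2) * indicator (ball 0 1) z \<partial>lborel)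
       = ennreal pi * (\<integral>\<^sup>+t. h t * indicator {0<..<1} t \<partial>lborel)"
proof -
  define M where "M = distr (density lborel (indicator (ball 0 1))) borel (\<lambda>z::complex. (cmod z)\<^sup>2)"
  define U where "U = density lborel (\<lambda>t::real. ennreal pi * indicator {0<..<1} t)"
  have disc: "emeasure lborel (ball (0::complex) r) = ennreal (pi * r\<^sup>2)"
    "emeasure lborel (cball (0::complex) r) = ennreal (pi * r\<^sup>2)" if "r \<ge> 0" for r
    using that by (simp_all add: emeasure_ball emeasure_cball unit_ball_vol_2)
  have eqM: "emeasure M {x<..} = emeasure lborel (ball 0 1 \<inter> {z::complex. x < (cmod z)\<^sup>2})" for x
  proof -
    have S: "{z::complex. x < (cmod z)\<^sup>2} \<in> sets borel" by measurable
    have "emeasure M {x<..} = emeasure (density lborel (indicator (ball 0 1))) {z::complex. x < (cmod z)\<^sup>2}"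
      unfolding M_def by (subst emeasure_distr) (simp_all add: vimage_def)
    also have "\<dots> = emeasure lborel (ball 0 1 \<inter> {z::complex. x < (cmod z)\<^sup>2})"
      using S by (intro emeasure_restricted) auto
    finally show ?thesis .
  qed
  have eqU: "emeasure U {x<..} = ennreal pi * emeasure lborel ({0<..<1} \<inter> {x<..})" for x
    unfolding U_def
    by (subst emeasure_density) (simp_all add: mult.assoc nn_integral_cmult indicator_inter_arith[symmetric])
  have eq: "emeasure M {x<..} = emeasure U {x<..}" for x
  proof -
    consider "x < 0" | "0 \<le> x" "x < 1" | "x \<ge> 1" by linarith
    then show ?thesis
    proof cases
      case 1
      then have "ball 0 1 \<inter> {z::complex. x < (cmod z)\<^sup>2} = ball 0 1" "{0<..<1} \<inter> {x<..} = {0<..<1}"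
        by (auto intro: less_le_trans[OF _ zero_le_power2])
      then show ?thesis by (simp add: eqM eqU disc)
    next
      case 2
      \<comment> \<open>The set is an annulus with inner radius \<open>sqrt x\<close>, hence of area
        pi - pi x.\<close>
      have *: "ball 0 1 \<inter> {z::complex. x < (cmod z)\<^sup>2} = ball 0 1 - cball 0 (sqrt x)"
      proof -
        have "x < (cmod z)\<^sup>2 \<longleftrightarrow> \<not> cmod z \<le> sqrt x" for z :: complex
          using real_sqrt_less_iff[of x "(cmod z)\<^sup>2"] by (simp add: not_le)
        then show ?thesis by (simp add: set_eq_iff)
      qed
      have **: "{0<..<1} \<inter> {x<..} = {x<..<1}" using 2 by auto
      have "cball (0::complex) (sqrt x) \<subseteq> ball 0 1"
        using 2 real_sqrt_lt_1_iff[of x] by (simp add: cball_subset_ball_iff)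
      then have "emeasure lborel (ball (0::complex) 1 - cball 0 (sqrt x)) = ennreal (pi - pi * x)"
        using 2 by (subst emeasure_Diff) (auto simp: disc ennreal_minus)
      then show ?thesis using 2
        by (simp add: eqM eqU * ** ennreal_mult[symmetric] right_diff_distrib)
    next
      case 3
      then have "ball 0 1 \<inter> {z::complex. x < (cmod z)\<^sup>2} = {}" "{0<..<1} \<inter> {x<..} = {}"
      proof -
        have "\<not> x < (cmod z)\<^sup>2" if "cmod z < 1" for z :: complex
          using that 3 abs_square_less_1[of "cmod z"] by simp
        then show "ball 0 1 \<inter> {z::complex. x < (cmod z)\<^sup>2} = {}" by auto
      qed (use 3 in auto)
      then show ?thesis by (simp add: eqM eqU)
    qed
  qed
  have "M = U"
  proof (rule measure_eqI_lessThan)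
    fix x
    have "emeasure M {x<..} \<le> emeasure lborel (ball (0::complex) 1)"
      unfolding eqM by (rule emeasure_mono) auto
    then show "emeasure M {x<..} < \<infinity>"
      using le_less_trans by (fastforce simp: disc)
  qed (auto simp: M_def U_def eq[unfolded M_def U_def])
  have "(\<integral>\<^sup>+z. h ((cmod z)\<^sup>2) * indicator (ball 0 1) z \<partial>lborel) = integral\<^sup>N M h"
    unfolding M_def
    by (subst nn_integral_distr, simp, simp, subst nn_integral_density)
       (simp_all add: mult.commute borel_measurable_indicator)
  also have "\<dots> = (\<integral>\<^sup>+t. (ennreal pi * indicator {0<..<1} t) * h t \<partial>lborel)"
    unfolding \<open>M = U\<close> U_def by (subst nn_integral_density) auto
  also have "\<dots> = ennreal pi * (\<integral>\<^sup>+t. h t * indicator {0<..<1} t \<partial>lborel)"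
    by (subst nn_integral_cmult[symmetric]) (auto intro!: nn_integral_cong simp: mult_ac)
  finally show ?thesis .
qed

section \<open>Closed form of the sum of simple poles and the Poisson kernel\<close>

text \<open>The sum is the logarithmic derivative of z^N - 1. Algebraically: z^N - 1 = z^N - (q^k)^N
  is divisible by z - q^k, and after summing the quotients over k, orthogonality of the roots of
  unity leaves a single power of z.\<close>

lemma Psi_closed_form:
  assumes N: "N > 0" and z: "z ^ N \<noteq> 1"
  shows "Psi N z = of_nat N * z ^ (N - 1) / (z ^ N - 1)"
proof -
  define q :: complex where "q = exp (2 * of_real pi * \<i> / of_nat N)"
  have q_power: "q ^ m = exp (2 * of_real pi * \<i> * of_nat m / of_nat N)" for m
    by (simp add: q_def exp_of_nat_mult[symmetric] mult_ac)
  have qN: "q ^ N = 1"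
    using N by (simp add: q_power exp_two_pi_i')
  have qm: "q ^ m \<noteq> 1" if "0 < m" "m < N" for m
    using that complex_root_unity_eq_1[of N m] by (simp add: q_power dvd_imp_le nat_dvd_not_less)
  have Psi: "Psi N z = (\<Sum>k<N. 1 / (z - q ^ k))"
    by (simp add: Psi_def q_power)
  have root: "(z ^ N - 1) / (z - q ^ k) = (\<Sum>j<N. z ^ j * (q ^ k) ^ (N - Suc j))" for k
  proof -
    have "(q ^ k) ^ N = 1" by (metis qN power_mult mult.commute power_one)
    moreover from this have "z \<noteq> q ^ k" using z by metis
    ultimately show ?thesis
      using power_diff_sumr2[of z N "q ^ k"] by (simp add: field_simps)
  qed
  \<comment> \<open>For j = N - 1 the exponent is 0 and every summand is 1. Otherwise 0 < N - Suc j
    < N, so this is a full geometric sum over an N-th root of unity other than 1.\<close>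
  have sum0: "(\<Sum>k<N. (q ^ k) ^ (N - Suc j)) = (if j = N - 1 then of_nat N else 0)" if "j < N" for j
  proof (cases "j = N - 1")
    case False
    define w where "w = q ^ (N - Suc j)"
    have "w \<noteq> 1" using that False unfolding w_def by (intro qm) auto
    have "w ^ N = 1" unfolding w_def by (metis qN power_mult mult.commute power_one)
    have "(\<Sum>k<N. (q ^ k) ^ (N - Suc j)) = (\<Sum>k<N. w ^ k)"
      unfolding w_def by (simp add: power_mult[symmetric] mult.commute)
    also have "\<dots> = 0" using \<open>w \<noteq> 1\<close> \<open>w ^ N = 1\<close> by (simp add: geometric_sum)
    finally show ?thesis using False by simp
  qed (use N in auto)
  have "(z ^ N - 1) * Psi N z = (\<Sum>k<N. (z ^ N - 1) / (z - q ^ k))"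
    by (simp add: Psi sum_distrib_left)
  also have "\<dots> = (\<Sum>j<N. z ^ j * (\<Sum>k<N. (q ^ k) ^ (N - Suc j)))"
    unfolding root sum_distrib_left by (rule sum.swap)
  also have "\<dots> = (\<Sum>j<N. if j = N - 1 then of_nat N * z ^ (N - 1) else 0)"
    by (intro sum.cong) (auto simp: sum0)
  also have "\<dots> = of_nat N * z ^ (N - 1)"
    using N by simp
  finally show ?thesis using z by (simp add: field_simps)
qed

text \<open>The numerator on the right is the Poisson kernel (1 - |w|^2) / |1 - w|^2, written
  through the real part of a holomorphic function. In this form it can be integrated by a power
  series.\<close>

lemma norm_inverse_one_minus_squared:
  fixes w :: complex
  assumes "cmod w < 1"
  shows "1 / (cmod (1 - w))\<^sup>2 = (2 * Re (1 / (1 - w)) - 1) / (1 - (cmod w)\<^sup>2)"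
proof -
  have "w \<noteq> 1" using assms by auto
  then have pos: "(cmod (1 - w))\<^sup>2 > 0" by simp
  have *: "(cmod (1 - w))\<^sup>2 = 1 - 2 * Re w + (cmod w)\<^sup>2"
    by (simp add: cmod_power2) (simp add: power2_eq_square algebra_simps)
  have "(cmod w)\<^sup>2 < 1" using assms by (simp add: abs_square_less_1)
  moreover have "Re (1 / (1 - w)) = (1 - Re w) / (cmod (1 - w))\<^sup>2"
    by (simp add: Re_divide cmod_power2)
  moreover have "2 * ((1 - Re w) / (cmod (1 - w))\<^sup>2) - 1 = (1 - (cmod w)\<^sup>2) / (cmod (1 - w))\<^sup>2"
    using pos by (simp add: field_simps) (simp add: *)
  ultimately show ?thesis by simp
qed

section \<open>Asymptotics of Beta values and of their sums\<close>

text \<open>For n > 0 this is Euler's limit \<open>Gamma_series'\<close> for Gamma, once its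
  factorial and its Pochhammer symbol are written as Gamma values.\<close>

lemma powr_Beta_tendsto_Gamma:
  fixes a :: real
  assumes "a > 0"
  shows "(\<lambda>n. real n powr a * Beta (real n) a) \<longlonglongrightarrow> Gamma a"
proof -
  have "\<forall>\<^sub>F n in sequentially. Gamma_series' a n = real n powr a * Beta (real n) a"
    using eventually_gt_at_top[of 0]
  proof eventually_elim
    case (elim n)
    have "pochhammer a n = Gamma (a + real n) / Gamma a"
      using assms by (intro pochhammer_Gamma) auto
    moreover have "fact (n - 1) = Gamma (real n)"
      using elim Gamma_fact[of "n - 1", where 'a = real] by (simp add: of_nat_diff)
    ultimately show ?case using elim
      by (simp add: Gamma_series'_def Beta_def powr_def add.commute)
  qed
  with Gamma_series'_LIMSEQ[of a] show ?thesis by (rule Lim_transform_eventually)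
qed

text \<open>With u n = n^a Beta n a, the k-th term is (k+1)^(-a) u(N(k+1)). For fixed k it tends to
  (k+1)^(-a) Gamma a, and boundedness of u dominates it by C (k+1)^(-a), uniformly in N. This series
  converges as a > 1, which gives both Tannery's limit and summability for each N.\<close>

lemma sum_Beta_tendsto:
  fixes a :: real
  assumes "a > 1"
  shows "(\<lambda>N. \<Sum>k. real N powr a * Beta (real (N * Suc k)) a) \<longlonglongrightarrow> Gamma a * zeta a"
    and "\<And>N. N > 0 \<Longrightarrow> summable (\<lambda>k. Beta (real (N * Suc k)) a)"
proof -
  define u where "u n = real n powr a * Beta (real n) a" for n
  have u: "u \<longlonglongrightarrow> Gamma a" unfolding u_def using assms by (intro powr_Beta_tendsto_Gamma) auto
  then have "Bseq u" by (intro convergent_imp_Bseq convergentI)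
  then obtain C where C: "\<And>n. norm (u n) \<le> C" unfolding Bseq_def by blast
  have eq: "real N powr a * Beta (real (N * Suc k)) a = 1 / real (Suc k) powr a * u (N * Suc k)"
    if "N > 0" for N k
    unfolding u_def of_nat_mult using that by (subst powr_mult) auto
  have summ: "summable (\<lambda>k. 1 / real (Suc k) powr a)"
    using assms summable_real_powr_iff[of "-a"] by (subst (asm) summable_Suc_iff[symmetric]) (simp add: powr_minus_divide)
  have bound: "norm (1 / real (Suc k) powr a * u (N * Suc k)) \<le> 1 / real (Suc k) powr a * C" for N k
    unfolding norm_mult using C by (intro mult_mono) auto
  show "summable (\<lambda>k. Beta (real (N * Suc k)) a)" if "N > 0" for N
  proof -
    have "summable (\<lambda>k. real N powr a * Beta (real (N * Suc k)) a)"
      unfolding eq[OF that]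
      by (rule summable_comparison_test'[OF summable_mult2[OF summ], of 0]) (rule bound)
    then show ?thesis using that by (subst (asm) summable_cmult_iff) auto
  qed
  have "(\<lambda>N. \<Sum>k. 1 / real (Suc k) powr a * u (N * Suc k)) \<longlonglongrightarrow> (\<Sum>k. 1 / real (Suc k) powr a * Gamma a)"
  proof (rule tannerys_theorem[THEN conjunct2, THEN conjunct2])
    fix k
    have "filterlim (\<lambda>N. N * Suc k) at_top sequentially"
      by (intro filterlim_subseq) (auto simp: strict_mono_def intro: mult_strict_right_mono simp del: mult_Suc_right)
    with u show "(\<lambda>N. 1 / real (Suc k) powr a * u (N * Suc k)) \<longlonglongrightarrow> 1 / real (Suc k) powr a * Gamma a"
      by (intro tendsto_intros filterlim_compose[OF u])
  next
    show "\<forall>\<^sub>F (k, N) in sequentially \<times>\<^sub>F sequentially.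
        norm (1 / real (Suc k) powr a * u (N * Suc k)) \<le> 1 / real (Suc k) powr a * C"
      using bound by (intro always_eventually) auto
  qed (use summable_mult2[OF summ] in simp_all)
  also have "(\<Sum>k. 1 / real (Suc k) powr a * Gamma a) = Gamma a * zeta a"
    using suminf_mult2[OF summ, of "Gamma a"] by (simp only: zeta_def mult.commute)
  \<comment> \<open>The scaling identity \<open>eq\<close> holds only for N > 0, so the two
    sequences agree eventually.\<close>
  finally show "(\<lambda>N. \<Sum>k. real N powr a * Beta (real (N * Suc k)) a) \<longlonglongrightarrow> Gamma a * zeta a"
    by (rule Lim_transform_eventually) (rule eventually_mono[OF eventually_gt_at_top[of 0]], simp only: eq)
qed

section \<open>Integrating the Poisson kernel against radial weights\<close>

lemma integral_rotation:
  fixes f :: "complex \<Rightarrow> 'b::{banach, second_countable_topology}"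
  assumes c: "cmod c = 1" and f: "f \<in> borel_measurable borel"
  shows "(\<integral>z. f (c * z) \<partial>lborel) = (\<integral>z. f z \<partial>lborel)"
proof -
  have "orthogonal_transformation ((*) c)"
    unfolding orthogonal_transformation using c
    by (auto simp: norm_mult linear_times)
  then have "(\<integral>z. f z \<partial>lborel) = (\<integral>z. f z \<partial>distr lborel borel ((*) c))"
    by (simp add: distr_orthogonal_lborel)
  also have "\<dots> = (\<integral>z. f (c * z) \<partial>lborel)"
    using f by (subst integral_distr) auto
  finally show ?thesis by simp
qed

text \<open>A rotation by c with c^n = -1 changes the sign of the integrand but not the integral.
  For a non-integrable integrand both facts hold with the default value 0.\<close>

lemma integral_radial_mult_power_eq_0:
  fixes \<psi> :: "real \<Rightarrow> real"
  assumes [measurable]: "\<psi> \<in> borel_measurable borel" and n: "n > 0"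
  shows "(\<integral>z. of_real (\<psi> (cmod z)) * z ^ n \<partial>lborel) = (0 :: complex)"
proof -
  define c where "c = cis (pi / real n)"
  have c: "cmod c = 1" "c ^ n = -1"
    using n by (simp_all add: c_def Complex.DeMoivre)
  define f where "f z = complex_of_real (\<psi> (cmod z)) * z ^ n" for z
  have [measurable]: "f \<in> borel_measurable borel" unfolding f_def by measurable
  have "f (c * z) = - f z" for z
    by (simp add: f_def norm_mult c power_mult_distrib)
  with integral_rotation[OF c(1), of f] have "- (\<integral>z. f z \<partial>lborel) = (\<integral>z. f z \<partial>lborel)"
    by simp
  then show ?thesis by (simp add: f_def[symmetric] neg_equal_iff_equal)
qed

lemma integrable_bounded_disc:
  fixes f :: "complex \<Rightarrow> 'b::{banach, second_countable_topology}"
  assumes "f \<in> borel_measurable borel" "\<And>z. norm (f z) \<le> B" "\<And>z. cmod z \<ge> 1 \<Longrightarrow> f z = 0"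
  shows "integrable lborel f"
proof (rule integrableI_bounded_set)
  show "AE z in lborel. z \<in> ball 0 1 \<longrightarrow> norm (f z) \<le> B" using assms by auto
  show "AE z in lborel. z \<notin> ball 0 1 \<longrightarrow> f z = 0" using assms by auto
qed (use assms emeasure_lborel_ball_finite in auto)

text \<open>In the geometric series of 1/(1 - z^n), every term except the constant one integrates to
  0 against a radial weight. Support in |z| < r with r < 1 keeps the partial sums bounded, so the
  series may be integrated termwise.\<close>

lemma integral_radial_geometric:
  fixes \<psi> :: "real \<Rightarrow> real"
  assumes meas [measurable]: "\<psi> \<in> borel_measurable borel"
    and bound: "\<And>t. \<bar>\<psi> t\<bar> \<le> B" and supp: "\<And>t. t \<ge> r \<Longrightarrow> \<psi> t = 0" and r: "r < 1" and n: "n > 0"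
  shows "integrable lborel (\<lambda>z. complex_of_real (\<psi> (cmod z)) * (1 / (1 - z ^ n)))"
    and "(\<integral>z. complex_of_real (\<psi> (cmod z)) * (1 / (1 - z ^ n)) \<partial>lborel)
       = of_real (\<integral>z. \<psi> (cmod (z::complex)) \<partial>lborel)"
proof -
  define s where "s K z = (\<Sum>k<K. complex_of_real (\<psi> (cmod z)) * z ^ (n * k))" for K z
  \<comment> \<open>A dominating function for the partial sums: on |z| < r they are at most B times
    the sum of all r^k, and elsewhere they vanish.\<close>
  define w where "w z = B / (1 - r) * indicator (ball 0 1) z" for z :: complex
  define S where "S z = complex_of_real (\<psi> (cmod z)) * (1 / (1 - z ^ n))" for z
  have B: "B \<ge> 0" using bound[of 0] by simp
  have s_sum: "s K z = complex_of_real (\<psi> (cmod z)) * (\<Sum>k<K. (z ^ n) ^ k)" for K z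
    by (simp add: s_def sum_distrib_left power_mult)
  have pow: "cmod (z ^ n) \<le> cmod z" if "cmod z < 1" for z :: complex
    using power_decreasing[of 1 n "cmod z"] that n by (simp add: norm_power)
  have term_le: "norm (complex_of_real (\<psi> (cmod z)) * z ^ m) \<le> B" for z m
  proof (cases "cmod z < 1")
    case True
    then have "\<bar>\<psi> (cmod z)\<bar> * cmod z ^ m \<le> B * 1"
      using bound B by (intro mult_mono power_le_one) auto
    then show ?thesis by (simp add: norm_mult norm_power)
  qed (use supp r B in auto)
  have term_int: "integrable lborel (\<lambda>z. complex_of_real (\<psi> (cmod z)) * z ^ m)" for m
    using term_le supp r by (intro integrable_bounded_disc[of _ B]) auto
  have \<psi>_int: "integrable lborel (\<lambda>z::complex. \<psi> (cmod z))"
    using bound supp r by (intro integrable_bounded_disc[of _ B]) auto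
  \<comment> \<open>The empty partial sum lacks the constant term, hence K > 0.\<close>
  have int_s: "(\<integral>z. s K z \<partial>lborel) = of_real (\<integral>z. \<psi> (cmod (z::complex)) \<partial>lborel)" if "K > 0" for K
  proof -
    have "(\<integral>z. s K z \<partial>lborel) = (\<Sum>k<K. \<integral>z. complex_of_real (\<psi> (cmod z)) * z ^ (n * k) \<partial>lborel)"
      unfolding s_def by (intro Bochner_Integration.integral_sum term_int)
    also have "\<dots> = (\<Sum>k<K. if k = 0 then of_real (\<integral>z. \<psi> (cmod (z::complex)) \<partial>lborel) else 0)"
      using n by (intro sum.cong) (auto simp: integral_radial_mult_power_eq_0)
    also have "\<dots> = of_real (\<integral>z. \<psi> (cmod (z::complex)) \<partial>lborel)"
      using that by simp
    finally show ?thesis .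
  qed
  have lim: "(\<lambda>K. s K z) \<longlonglongrightarrow> S z" for z
  proof (cases "cmod z < 1")
    case True
    then have "cmod (z ^ n) < 1" using pow by (meson le_less_trans)
    then have "(\<lambda>k. (z ^ n) ^ k) sums (1 / (1 - z ^ n))" by (rule geometric_sums)
    then show ?thesis unfolding s_sum S_def sums_def by (intro tendsto_intros)
  qed (use supp r in \<open>simp add: s_def S_def\<close>)
  have dom: "norm (s K z) \<le> w z" for K z
  proof (cases "cmod z < r")
    case True
    then have z: "cmod z < 1" using r by simp
    have "norm (\<Sum>k<K. (z ^ n) ^ k) \<le> (\<Sum>k<K. r ^ k)"
      using True pow[OF z] by (intro sum_norm_le) (auto simp: norm_power[of "z ^ n"] intro!: power_mono)
    also have "\<dots> \<le> 1 / (1 - r)"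
    proof -
      have "r \<ge> 0" using True norm_ge_zero[of z] by linarith
      then show ?thesis using r sum_le_suminf[of "\<lambda>k. r ^ k" "{..<K}"] by (simp add: suminf_geometric)
    qed
    finally have "norm (s K z) \<le> B * (1 / (1 - r))"
      unfolding s_sum norm_mult using bound B by (intro mult_mono) auto
    then show ?thesis using z by (simp add: w_def)
  qed (use supp r B in \<open>simp add: s_def w_def\<close>)
  have [measurable]: "s K \<in> borel_measurable borel" "S \<in> borel_measurable borel" for K
    unfolding s_def S_def by measurable
  have [measurable]: "w \<in> borel_measurable borel"
    unfolding w_def by (intro borel_measurable_times borel_measurable_indicator) auto
  have w_int: "integrable lborel w"
    using r B by (intro integrable_bounded_disc[of _ "B / (1 - r)"]) (auto simp: w_def indicator_def)
  show S_int: "integrable lborel S"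
    by (rule integrable_dominated_convergence[of S lborel s w]) (use lim dom w_int in auto)
  have "(\<lambda>K. \<integral>z. s K z \<partial>lborel) \<longlonglongrightarrow> (\<integral>z. S z \<partial>lborel)"
    by (rule integral_dominated_convergence[where w = w]) (use lim dom w_int in auto)
  moreover have "(\<lambda>K. \<integral>z. s K z \<partial>lborel) \<longlonglongrightarrow> of_real (\<integral>z. \<psi> (cmod (z::complex)) \<partial>lborel)"
    by (intro tendsto_eventually eventually_mono[OF eventually_gt_at_top[of 0]] int_s)
  ultimately show "(\<integral>z. S z \<partial>lborel) = of_real (\<integral>z. \<psi> (cmod (z::complex)) \<partial>lborel)"
    by (rule LIMSEQ_unique)
qed

text \<open>Monotone convergence along discs of radius below 1; it carries identities on compact
  subdiscs over to the whole disc.\<close>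

lemma nn_integral_exhaust_disc:
  fixes h :: "complex \<Rightarrow> ennreal"
  assumes [measurable]: "h \<in> borel_measurable borel"
  shows "(\<lambda>i. \<integral>\<^sup>+z. h z * indicator (ball 0 (1 - 1 / real (Suc i))) z \<partial>lborel)
          \<longlonglongrightarrow> (\<integral>\<^sup>+z. h z * indicator (ball 0 1) z \<partial>lborel)"
proof (rule nn_integral_LIMSEQ)
  have mono: "ball (0::complex) (1 - 1 / real (Suc i)) \<subseteq> ball 0 (1 - 1 / real (Suc j))" if "i \<le> j" for i j
    using that by (intro subset_ball) (simp add: frac_le)
  show "incseq (\<lambda>i z. h z * indicator (ball 0 (1 - 1 / real (Suc i))) z)"
    unfolding incseq_def le_fun_def
  proof (intro allI impI mult_left_mono)
    fix i j :: nat and z :: complex assume "i \<le> j"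
    then show "indicator (ball 0 (1 - 1 / real (Suc i))) z \<le> (indicator (ball 0 (1 - 1 / real (Suc j))) z :: ennreal)"
      using subsetD[OF mono[of i j], of z] by (auto split: split_indicator)
  qed auto
  fix z
  show "(\<lambda>i. h z * indicator (ball 0 (1 - 1 / real (Suc i))) z) \<longlonglongrightarrow> h z * indicator (ball 0 1) z"
  proof (cases "cmod z < 1")
    case True
    have "(\<lambda>i. 1 - 1 / real (Suc i)) \<longlonglongrightarrow> 1 - 0"
      by (intro tendsto_diff tendsto_const LIMSEQ_Suc lim_1_over_n)
    then have "\<forall>\<^sub>F i in sequentially. cmod z < 1 - 1 / real (Suc i)"
      using True by (intro order_tendstoD(1)) auto
    then show ?thesis
      using True by (intro tendsto_eventually) (auto elim: eventually_mono)
  next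
    case False
    then have "\<not> cmod z < 1 - 1 / real (Suc i)" for i
      by (smt (verit) divide_nonneg_nonneg of_nat_0_le_iff)
    then show ?thesis using False by (simp add: indicator_def)
  qed
qed (intro borel_measurable_times_ennreal borel_measurable_indicator; auto)

text \<open>The factor 1/|1 - z^n|^2 is the Poisson kernel at z^n divided by 1 - |z|^(2n), and the
  kernel averages to 1 over circles. Near the unit circle the integrands may be unbounded, so
  equality is shown on discs of radius r < 1 and passed to the limit in
  \<open>ennreal\<close>.\<close>

lemma nn_integral_radial_Poisson:
  fixes g :: "real \<Rightarrow> real"
  assumes [measurable]: "g \<in> borel_measurable borel"
    and g: "\<And>t. 0 \<le> t \<Longrightarrow> t < 1 \<Longrightarrow> 0 \<le> g t \<and> g t \<le> B" and n: "n > 0"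
  shows "(\<integral>\<^sup>+z. ennreal (g (cmod z) / (cmod (1 - z ^ n))\<^sup>2) * indicator (ball 0 1) z \<partial>lborel)
       = (\<integral>\<^sup>+z. ennreal (g (cmod z) / (1 - ((cmod z)\<^sup>2) ^ n)) * indicator (ball (0::complex) 1) z \<partial>lborel)"
    (is "integral\<^sup>N lborel (\<lambda>z. ?L z * _) = integral\<^sup>N lborel (\<lambda>z. ?R z * _)")
proof -
  have B: "B \<ge> 0" using g[of 0] by simp
  have eq: "(\<integral>\<^sup>+z. ?L z * indicator (ball 0 r) z \<partial>lborel) = (\<integral>\<^sup>+z. ?R z * indicator (ball 0 r) z \<partial>lborel)"
    if r: "r < 1" for r
  proof -
    \<comment> \<open>The cut-off at r keeps the quotient bounded, and 1/(1 - t^(2n)) becomes part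
      of the radial weight.\<close>
    define \<psi> where "\<psi> t = g t / (1 - (t\<^sup>2) ^ n) * indicator {0..<r} t" for t
    have [measurable]: "\<psi> \<in> borel_measurable borel" unfolding \<psi>_def by measurable
    have den: "1 - r\<^sup>2 \<le> 1 - (t\<^sup>2) ^ n" "1 - r\<^sup>2 > 0" if "0 \<le> t" "t < r" for t
    proof -
      have "t\<^sup>2 \<le> r\<^sup>2" "t\<^sup>2 < 1" "r\<^sup>2 < 1"
        using that r by (auto simp: power_mono abs_square_less_1)
      moreover have "(t\<^sup>2) ^ n \<le> (t\<^sup>2) ^ 1"
        using n \<open>t\<^sup>2 < 1\<close> by (intro power_decreasing) auto
      ultimately show "1 - r\<^sup>2 \<le> 1 - (t\<^sup>2) ^ n" "1 - r\<^sup>2 > 0" by auto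
    qed
    have \<psi>_nonneg: "\<psi> t \<ge> 0" for t
      using den[of t] g[of t] r by (auto simp: \<psi>_def indicator_def)
    \<comment> \<open>The outer absolute value covers r < -1, where \<open>{0..<r}\<close> is empty
      and 1 - r^2 is negative.\<close>
    have \<psi>_bound: "\<bar>\<psi> t\<bar> \<le> \<bar>B / (1 - r\<^sup>2)\<bar>" for t
    proof (cases "0 \<le> t \<and> t < r")
      case True
      then have "g t / (1 - (t\<^sup>2) ^ n) \<le> B / (1 - r\<^sup>2)"
        using den[of t] g[of t] r by (intro frac_le) auto
      moreover have "\<psi> t = g t / (1 - (t\<^sup>2) ^ n)" using True by (simp add: \<psi>_def)
      ultimately show ?thesis using \<psi>_nonneg[of t] by linarith
    qed (auto simp: \<psi>_def indicator_def)
    have \<psi>_supp: "\<psi> t = 0" if "t \<ge> r" for t using that by (simp add: \<psi>_def)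
    note G = integral_radial_geometric[of \<psi>, OF _ \<psi>_bound \<psi>_supp r n]
    \<comment> \<open>The integrand of the left side on the disc of radius r, with the Poisson
      kernel written as 2 Re (1/(1 - z^n)) - 1.\<close>
    define P where "P z = \<psi> (cmod z) * (2 * Re (1 / (1 - z ^ n)) - 1)" for z
    have L: "?L z * indicator (ball 0 r) z = ennreal (P z)" and P_nonneg: "P z \<ge> 0" for z
    proof -
      have "g (cmod z) / (cmod (1 - z ^ n))\<^sup>2 * indicator (ball 0 r) z = P z"
      proof (cases "cmod z < r")
        case True
        then have "cmod (z ^ n) < 1" using r n by (simp add: norm_power power_less_one_iff)
        from norm_inverse_one_minus_squared[OF this] True show ?thesis
          by (simp add: P_def \<psi>_def norm_power power_mult[symmetric] mult.commute)
            (simp add: divide_inverse)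
      qed (simp add: P_def \<psi>_def)
      moreover have "g (cmod z) / (cmod (1 - z ^ n))\<^sup>2 * indicator (ball 0 r) z \<ge> 0"
        using g[of "cmod z"] r by (auto simp: indicator_def)
      ultimately show "?L z * indicator (ball 0 r) z = ennreal (P z)" "P z \<ge> 0"
        by (auto simp: indicator_def)
    qed
    have R: "?R z * indicator (ball 0 r) z = ennreal (\<psi> (cmod z))" for z :: complex
      by (auto simp: \<psi>_def indicator_def)
    have \<psi>_int: "integrable lborel (\<lambda>z::complex. \<psi> (cmod z))"
      using \<psi>_bound \<psi>_supp r by (intro integrable_bounded_disc[of _ "\<bar>B / (1 - r\<^sup>2)\<bar>"]) auto
    have Re_int: "integrable lborel (\<lambda>z. Re (complex_of_real (\<psi> (cmod z)) * (1 / (1 - z ^ n))))"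
      using G(1) by (intro integrable_Re) auto
    have P_eq: "P = (\<lambda>z. 2 * Re (complex_of_real (\<psi> (cmod z)) * (1 / (1 - z ^ n))) - \<psi> (cmod z))"
      by (simp add: P_def fun_eq_iff algebra_simps del: times_divide_eq_right)
    have "(\<integral>z. Re (complex_of_real (\<psi> (cmod z)) * (1 / (1 - z ^ n))) \<partial>lborel) = (\<integral>z. \<psi> (cmod (z::complex)) \<partial>lborel)"
      using G by (subst integral_Re) auto
    \<comment> \<open>With I the integral of the weight, the real part also integrates to I, and 2 I
      - I = I.\<close>
    then have "(\<integral>z. P z \<partial>lborel) = (\<integral>z. \<psi> (cmod (z::complex)) \<partial>lborel)"
      unfolding P_eq using Re_int \<psi>_int by (subst Bochner_Integration.integral_diff) auto
    moreover have "integrable lborel P"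
      unfolding P_eq using Re_int \<psi>_int by (intro Bochner_Integration.integrable_diff integrable_mult_right) auto
    ultimately show ?thesis
      unfolding L R using \<psi>_int \<psi>_nonneg P_nonneg by (simp add: nn_integral_eq_integral)
  qed
  have "(\<lambda>i. \<integral>\<^sup>+z. ?L z * indicator (ball 0 (1 - 1 / real (Suc i))) z \<partial>lborel)
          \<longlonglongrightarrow> (\<integral>\<^sup>+z. ?L z * indicator (ball 0 1) z \<partial>lborel)"
    by (rule nn_integral_exhaust_disc) measurable
  moreover have "(\<lambda>i. \<integral>\<^sup>+z. ?R z * indicator (ball 0 (1 - 1 / real (Suc i))) z \<partial>lborel)
          \<longlonglongrightarrow> (\<integral>\<^sup>+z. ?R z * indicator (ball (0::complex) 1) z \<partial>lborel)"
    by (rule nn_integral_exhaust_disc) measurable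
  \<comment> \<open>Each radius 1 - 1/(i+1) is below 1, so by \<open>eq\<close> the two sequences
    coincide and have the same limit.\<close>
  ultimately show ?thesis
    by (subst (asm) eq) (auto intro: LIMSEQ_unique)
qed

section \<open>The norm as an exact sum of Beta values\<close>

lemma Beta_real_nonneg:
  fixes a b :: real
  assumes "a > 0" "b > 0"
  shows "Beta a b \<ge> 0"
  using Gamma_real_pos[of a] Gamma_real_pos[of b] Gamma_real_pos[of "a + b"] assms
  by (simp add: Beta_def)

text \<open>Expanding 1/(1 - t^N) turns the integrand into a sum of Beta integrands t^(N(k+1)-1)
  (1-t)^(a-1). All terms are nonnegative, so sum and integral commute.\<close>

lemma nn_integral_geometric_Beta:
  fixes a :: real
  assumes a: "a > 1" and N: "N > 0"
  shows "(\<integral>\<^sup>+t. ennreal (t ^ (N - 1) * (1 - t) powr (a - 1) / (1 - t ^ N)) * indicator {0<..<1} t \<partial>lborel)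
       = ennreal (\<Sum>k. Beta (real (N * Suc k)) a)"
proof -
  define f where "f k t = t powr (real (N * Suc k) - 1) * (1 - t) powr (a - 1)" for k t
  have [measurable]: "f k \<in> borel_measurable borel" for k unfolding f_def by measurable
  have f_int: "(\<integral>\<^sup>+t. ennreal (f k t) * indicator {0<..<1} t \<partial>lborel) = ennreal (Beta (real (N * Suc k)) a)" for k
  proof (rule nn_integral_has_integral_lebesgue')
    show "(f k has_integral Beta (real (N * Suc k)) a) {0<..<1}"
      using has_integral_Beta_real[of "real (N * Suc k)" a] a N
      unfolding f_def has_integral_Icc_iff_Ioo by (simp del: mult_Suc_right)
  qed (simp add: f_def)
  have sums: "(\<lambda>k. f k t) sums (t ^ (N - 1) * (1 - t) powr (a - 1) / (1 - t ^ N))"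
    if t: "0 < t" "t < 1" for t
  proof -
    have eq: "f k t = (t ^ (N - 1) * (1 - t) powr (a - 1)) * (t ^ N) ^ k" for k
    proof -
      \<comment> \<open>The exponent splits as (N - 1) + N k; truncated subtraction is harmless
        because N > 0.\<close>
      have "real (N * Suc k) - 1 = real (N - 1 + N * k)" using N by (simp add: of_nat_diff algebra_simps)
      then have "t powr (real (N * Suc k) - 1) = t ^ (N - 1 + N * k)"
        using t by (metis powr_realpow)
      then show ?thesis by (simp add: f_def power_add power_mult)
    qed
    have "t ^ N < 1" using t N by (simp add: power_less_one_iff)
    then have "(\<lambda>k. (t ^ N) ^ k) sums (1 / (1 - t ^ N))"
      using t by (intro geometric_sums) (simp add: abs_of_pos)
    then show ?thesis
      unfolding eq using sums_mult by (metis times_divide_eq_right mult.right_neutral)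
  qed
  have "(\<integral>\<^sup>+t. ennreal (t ^ (N - 1) * (1 - t) powr (a - 1) / (1 - t ^ N)) * indicator {0<..<1} t \<partial>lborel)
      = (\<integral>\<^sup>+t. (\<Sum>k. ennreal (f k t) * indicator {0<..<1} t) \<partial>lborel)"
  proof (rule nn_integral_cong)
    fix t :: real
    show "ennreal (t ^ (N - 1) * (1 - t) powr (a - 1) / (1 - t ^ N)) * indicator {0<..<1} t
        = (\<Sum>k. ennreal (f k t) * indicator {0<..<1} t)"
    proof (cases "t \<in> {0<..<1}")
      case True
      then have s: "(\<lambda>k. f k t) sums (t ^ (N - 1) * (1 - t) powr (a - 1) / (1 - t ^ N))"
        by (intro sums) auto
      have "(\<Sum>k. ennreal (f k t)) = ennreal (\<Sum>k. f k t)"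
        by (rule suminf_ennreal2) (use s sums_summable in \<open>auto simp: f_def\<close>)
      then show ?thesis using True s by (simp add: sums_iff)
    qed simp
  qed
  also have "\<dots> = (\<Sum>k. \<integral>\<^sup>+t. ennreal (f k t) * indicator {0<..<1} t \<partial>lborel)"
    by (rule nn_integral_suminf) measurable
  also have "\<dots> = (\<Sum>k. ennreal (Beta (real (N * Suc k)) a))"
    by (simp only: f_int)
  also have "\<dots> = ennreal (\<Sum>k. Beta (real (N * Suc k)) a)"
  \<comment> \<open>Summability makes the value finite, so the sum may be taken in the
    reals.\<close>
  proof (rule suminf_ennreal2)
    show "0 \<le> Beta (real (N * Suc k)) a" for k
      using a N by (intro Beta_real_nonneg) (auto simp del: of_nat_mult mult_Suc_right)
  qed (use sum_Beta_tendsto(2)[OF a N] in simp)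
  finally show ?thesis .
qed

lemma weighted_norm_Psi:
  assumes \<alpha>: "\<alpha> > 0" and N: "N > 0"
  shows "(weighted_norm \<alpha> (Psi N))\<^sup>2 = (\<alpha> + 1) * (real N)\<^sup>2 * (\<Sum>k. Beta (real (N * Suc k)) (\<alpha> + 1))"
proof -
  \<comment> \<open>What remains of the integrand, as a function of t = |z|, after N^2 and 1/|1 -
    z^N|^2 are split off. It is bounded by 1 because \<alpha> > 0.\<close>
  define g where "g t = (t\<^sup>2) ^ (N - 1) * (1 - t\<^sup>2) powr \<alpha>" for t :: real
  define F where "F z = (cmod (Psi N z))\<^sup>2 * (1 - (cmod z)\<^sup>2) powr \<alpha>" for z
  define S where "S = (\<Sum>k. Beta (real (N * Suc k)) (\<alpha> + 1))"
  have [measurable]: "g \<in> borel_measurable borel" unfolding g_def by measurable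
  have [measurable]: "F \<in> borel_measurable borel" unfolding F_def Psi_def by measurable
  have [measurable]: "(indicator (ball 0 1) :: complex \<Rightarrow> real) \<in> borel_measurable borel"
      "(indicator (ball 0 1) :: complex \<Rightarrow> ennreal) \<in> borel_measurable borel"
    by (intro borel_measurable_indicator; simp)+
  have F_nonneg: "F z \<ge> 0" for z by (simp add: F_def)
  have g_bound: "0 \<le> g t \<and> g t \<le> 1" if "0 \<le> t" "t < 1" for t
  proof -
    have "t\<^sup>2 \<le> 1" using that by (simp add: power_le_one)
    then have "(t\<^sup>2) ^ (N - 1) * (1 - t\<^sup>2) powr \<alpha> \<le> 1 * 1"
      using \<alpha> by (intro mult_mono power_le_one powr_le1) (use that in auto)
    then show ?thesis by (simp add: g_def)
  qed
  have F_eq: "ennreal (F z) * indicator (ball 0 1) z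
      = ennreal ((real N)\<^sup>2) * (ennreal (g (cmod z) / (cmod (1 - z ^ N))\<^sup>2) * indicator (ball 0 1) z)" for z
  proof (cases "cmod z < 1")
    case True
    then have "cmod (z ^ N) < 1" using N by (simp add: norm_power power_less_one_iff)
    then have "Psi N z = of_nat N * z ^ (N - 1) / (z ^ N - 1)"
      using N by (intro Psi_closed_form) auto
    then have "F z = (real N)\<^sup>2 * (g (cmod z) / (cmod (1 - z ^ N))\<^sup>2)"
      by (simp add: F_def g_def norm_divide norm_mult norm_power power_divide power_mult_distrib
          norm_minus_commute[of "z ^ N"] power_mult[symmetric] mult.commute[of 2])
    moreover have "g (cmod z) / (cmod (1 - z ^ N))\<^sup>2 \<ge> 0" using g_bound True by simp
    ultimately show ?thesis using True by (simp add: ennreal_mult del: times_divide_eq_right)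
  qed simp
  have "(\<integral>\<^sup>+z. ennreal (F z) * indicator (ball 0 1) z \<partial>lborel)
      = ennreal ((real N)\<^sup>2) * (\<integral>\<^sup>+z. ennreal (g (cmod z) / (cmod (1 - z ^ N))\<^sup>2) * indicator (ball 0 1) z \<partial>lborel)"
    unfolding F_eq by (rule nn_integral_cmult) (intro borel_measurable_times_ennreal borel_measurable_indicator; measurable)
  also have "(\<integral>\<^sup>+z. ennreal (g (cmod z) / (cmod (1 - z ^ N))\<^sup>2) * indicator (ball 0 1) z \<partial>lborel)
      = (\<integral>\<^sup>+z. ennreal (g (cmod z) / (1 - ((cmod z)\<^sup>2) ^ N)) * indicator (ball (0::complex) 1) z \<partial>lborel)"
    by (rule nn_integral_radial_Poisson[OF _ g_bound N]) measurable
  \<comment> \<open>The exponent \<alpha> is written as \<alpha> + 1 - 1 to match the Beta integral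
    with second parameter \<alpha> + 1.\<close>
  also have "\<dots> = ennreal pi *
      (\<integral>\<^sup>+t. ennreal (t ^ (N - 1) * (1 - t) powr (\<alpha> + 1 - 1) / (1 - t ^ N)) * indicator {0<..<1} t \<partial>lborel)"
    unfolding g_def by (subst nn_integral_radial_disc[symmetric]) simp_all
  also have "\<dots> = ennreal (pi * S)"
    using \<alpha> N by (subst nn_integral_geometric_Beta) (simp_all add: S_def ennreal_mult')
  finally have *: "(\<integral>\<^sup>+z. ennreal (F z) * indicator (ball 0 1) z \<partial>lborel) = ennreal ((real N)\<^sup>2 * (pi * S))"
    by (simp add: ennreal_mult')
  have S: "S \<ge> 0"
    unfolding S_def using \<alpha> N sum_Beta_tendsto(2)[of "\<alpha> + 1" N]
    by (intro suminf_nonneg Beta_real_nonneg) (auto simp del: of_nat_mult mult_Suc_right)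
  \<comment> \<open>Return from \<open>ennreal\<close> to the Bochner integral. The density 1/pi of
    \<open>m2\<close> will cancel the pi from radial integration.\<close>
  have "(LINT z:ball 0 1|m2. F z) = enn2real (\<integral>\<^sup>+z. ennreal (indicator (ball 0 1) z * F z) \<partial>m2)"
    unfolding set_lebesgue_integral_def real_scaleR_def
    by (rule integral_eq_nn_integral) (auto simp: m2_def F_nonneg split: split_indicator)
  also have "(\<integral>\<^sup>+z. ennreal (indicator (ball 0 1) z * F z) \<partial>m2)
      = (\<integral>\<^sup>+z. ennreal (1 / pi) * (ennreal (F z) * indicator (ball 0 1) z) \<partial>lborel)"
    unfolding m2_def by (subst nn_integral_density) (auto intro!: nn_integral_cong split: split_indicator)
  also have "\<dots> = ennreal (1 / pi) * ennreal ((real N)\<^sup>2 * (pi * S))"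
    by (subst nn_integral_cmult) (simp_all add: *)
  also have "\<dots> = ennreal ((real N)\<^sup>2 * S)"
    using S by (subst ennreal_mult[symmetric]) auto
  finally have "(LINT z:ball 0 1|m2. F z) = (real N)\<^sup>2 * S"
    using S by simp
  \<comment> \<open>Nonnegativity of \<open>S\<close> lets the square undo the root in
    \<open>weighted_norm\<close>.\<close>
  then show ?thesis
    using \<alpha> S by (simp add: weighted_norm_def F_def S_def mult.assoc)
qed

section \<open>The limit and its positivity\<close>

theorem theorem3:
  fixes \<alpha> :: real
  assumes "\<alpha> > 0"
  shows "((\<lambda>N. real N powr (\<alpha> - 1) * (weighted_norm \<alpha> (Psi N))\<^sup>2)
           \<longlonglongrightarrow> Gamma (\<alpha> + 2) * zeta (\<alpha> + 1))
         \<and> Gamma (\<alpha> + 2) * zeta (\<alpha> + 1) > 0"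
proof
  \<comment> \<open>The functional equation absorbs the normalizing factor \<alpha> + 1 of the
    norm.\<close>
  have Gamma: "Gamma (\<alpha> + 2) = (\<alpha> + 1) * Gamma (\<alpha> + 1)"
    using Gamma_plus1[of "\<alpha> + 1"] nonpos_Ints_nonpos[of "\<alpha> + 1"] assms by (fastforce simp: add.assoc)
  have "(\<lambda>N. (\<alpha> + 1) * (\<Sum>k. real N powr (\<alpha> + 1) * Beta (real (N * Suc k)) (\<alpha> + 1)))
      \<longlonglongrightarrow> (\<alpha> + 1) * (Gamma (\<alpha> + 1) * zeta (\<alpha> + 1))"
    using assms by (intro tendsto_mult tendsto_const sum_Beta_tendsto) auto
  moreover have "\<forall>\<^sub>F N in sequentially.
      (\<alpha> + 1) * (\<Sum>k. real N powr (\<alpha> + 1) * Beta (real (N * Suc k)) (\<alpha> + 1))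
        = real N powr (\<alpha> - 1) * (weighted_norm \<alpha> (Psi N))\<^sup>2"
    using eventually_gt_at_top[of 0]
  proof eventually_elim
    case (elim N)
    \<comment> \<open>The N^2 from the closed form raises the exponent from \<alpha> - 1 to the
      \<alpha> + 1 required by the Beta asymptotics.\<close>
    have "real N powr (\<alpha> + 1) = real N powr (\<alpha> - 1) * (real N)\<^sup>2"
      using elim powr_add[of "real N" "\<alpha> - 1" 2] by (simp add: powr_numeral add.commute)
    moreover have "(\<Sum>k. real N powr (\<alpha> + 1) * Beta (real (N * Suc k)) (\<alpha> + 1))
        = real N powr (\<alpha> + 1) * (\<Sum>k. Beta (real (N * Suc k)) (\<alpha> + 1))"
      using assms elim by (intro suminf_mult sum_Beta_tendsto) auto
    ultimately show ?case
      using weighted_norm_Psi[OF assms elim] by (simp only: mult_ac)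
  qed
  ultimately have "(\<lambda>N. real N powr (\<alpha> - 1) * (weighted_norm \<alpha> (Psi N))\<^sup>2)
      \<longlonglongrightarrow> (\<alpha> + 1) * (Gamma (\<alpha> + 1) * zeta (\<alpha> + 1))"
    by (rule Lim_transform_eventually)
  then show "(\<lambda>N. real N powr (\<alpha> - 1) * (weighted_norm \<alpha> (Psi N))\<^sup>2)
      \<longlonglongrightarrow> Gamma (\<alpha> + 2) * zeta (\<alpha> + 1)"
    by (simp only: Gamma mult.assoc)
  have "summable (\<lambda>k. real k powr (- \<alpha> - 1))"
    using assms by (simp add: summable_real_powr_iff)
  then have "summable (\<lambda>k. 1 / real (Suc k) powr (\<alpha> + 1))"
    by (subst (asm) summable_Suc_iff[symmetric]) (simp add: powr_minus_divide[symmetric])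
  then have "zeta (\<alpha> + 1) > 0"
    unfolding zeta_def by (intro suminf_pos) auto
  then show "Gamma (\<alpha> + 2) * zeta (\<alpha> + 1) > 0"
    using assms by (intro mult_pos_pos Gamma_real_pos) auto
qed

end
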